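(* Let $n\geq3$. The monoid $\mathcal{DPC}_n$ is defined by the presentation $\langle A\mid R\rangle$ on $n+2$ generators, where $A=\{g,h,e_1,e_2,\ldots,e_n\}$ and $R$ is the set of the following monoid relations: $(R_1)$ $g^n=1$, $h^2=1$ and $hg=g^{n-1}h$; $(R_2)$ $e_i^2=e_i$, for $1\leq i\leq n$; $(R_3)$ $e_ie_j=e_je_i$, for $1\leq i<j\leq n$; $(R_4)$ $ge_1=e_ng$ and $ge_{i+1}=e_ig$, for $1\leq i\leq n-1$; $(R_5)$ $he_i=e_{n-i+1}h$, for $1\leq i\leq n$; $(R_6^{\mathrm{o}})$ $hge_2e_3\cdots e_n=e_2e_3\cdots e_n$, if $n$ is odd; $(R_6^{\mathrm{e}})$ $hge_2\cdots e_{\frac n2}e_{\frac n2+2}\cdots e_n=e_2\cdots e_{\frac n2}e_{\frac n2+2}\cdots e_n$ and $he_1e_2\cdots e_n=e_1e_2\cdots e_n$, if $n$ is even.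
   Context: A monoid $M$ is defined by a presentation $\langle A\mid R\rangle$, where $A$ is an alphabet and $R\subseteq A^*\times A^*$ is a set of relations of the free monoid $A^*$ (a pair $(u,v)$ being written $u=v$), if $M\cong A^*/\rho_R$, where $\rho_R$ is the smallest congruence on $A^*$ containing $R$. For $n\geq3$, $C_n$ is the cycle graph with vertex set $\{1,\ldots,n\}$ and edges $\{i,i+1\}$ ($1\leq i\leq n-1$) and $\{1,n\}$; $\mathrm{d}(x,y)=\min\{|x-y|,n-|x-y|\}$ is the geodesic distance in $C_n$. $\mathcal{DPC}_n$ is the monoid, under composition (maps written on the right and composed from left to right), of all partial isometries of $C_n$, i.e. of all partial transformations $\alpha$ of $\{1,\ldots,n\}$ (including the empty one) such that $\mathrm{d}(x\alpha,y\alpha)=\mathrm{d}(x,y)$ for all $x,y\in\mathrm{Dom}(\alpha)$. In the presentation, the letters correspond to the following elements of $\mathcal{DPC}_n$: $g$ to the permutation with $ig=i+1$ for $i<n$ and $ng=1$; $h$ to the permutation with $ih=n+1-i$; $e_i$ to the identity map on $\{1,\ldots,n\}\setminus\{i\}$. A product $e_2\cdots e_{\frac n2}e_{\frac n2+2}\cdots e_n$ is the product of the letters $e_2,\ldots,e_n$ in increasing order of index with $e_{\frac n2+1}$ omitted. *)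

theory Defs
  imports Complex_Main "HOL-Algebra.Group"
begin

section \<open>Monoid presentations\<close>

definition free_monoid :: "'a set \<Rightarrow> 'a list monoid" where
  "free_monoid A = \<lparr>carrier = lists A, monoid.mult = (@), one = []\<rparr>"

definition congruence_on :: "('m, 'b) monoid_scheme \<Rightarrow> ('m \<times> 'm) set \<Rightarrow> bool" where
  "congruence_on M \<rho> \<longleftrightarrow> equiv (carrier M) \<rho> \<and>
     (\<forall>(a, b) \<in> \<rho>. \<forall>(c, d) \<in> \<rho>. (a \<otimes>\<^bsub>M\<^esub> c, b \<otimes>\<^bsub>M\<^esub> d) \<in> \<rho>)"

definition generated_congruence ::
    "('m, 'b) monoid_scheme \<Rightarrow> ('m \<times> 'm) set \<Rightarrow> ('m \<times> 'm) set" where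
  "generated_congruence M R = \<Inter> {\<rho>. congruence_on M \<rho> \<and> R \<subseteq> \<rho>}"

text \<open>
  When \<open>\<rho>\<close> is a congruence, all the classes in the union defining the product coincide.
\<close>

definition quotient_monoid ::
    "('m, 'b) monoid_scheme \<Rightarrow> ('m \<times> 'm) set \<Rightarrow> 'm set monoid" where
  "quotient_monoid M \<rho> =
     \<lparr>carrier = carrier M // \<rho>,
      monoid.mult = (\<lambda>X Y. \<Union>a\<in>X. \<Union>b\<in>Y. \<rho> `` {a \<otimes>\<^bsub>M\<^esub> b}),
      one = \<rho> `` {\<one>\<^bsub>M\<^esub>}\<rparr>"

definition presented_congruence ::
    "'a set \<Rightarrow> ('a list \<times> 'a list) set \<Rightarrow> ('a list \<times> 'a list) set" where
  "presented_congruence A R = generated_congruence (free_monoid A) R"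

definition presented_monoid ::
    "'a set \<Rightarrow> ('a list \<times> 'a list) set \<Rightarrow> 'a list set monoid" where
  "presented_monoid A R = quotient_monoid (free_monoid A) (presented_congruence A R)"

definition defined_by_presentation ::
    "('m, 'b) monoid_scheme \<Rightarrow> 'a set \<Rightarrow> ('a list \<times> 'a list) set \<Rightarrow> bool" where
  "defined_by_presentation M A R \<longleftrightarrow> R \<subseteq> lists A \<times> lists A \<and> M \<cong> presented_monoid A R"

text \<open>
  The stronger form in which each letter \<open>a\<close> stands for a specified element \<open>\<phi> a\<close> of \<open>M\<close>.
\<close>

definition defined_by_presentation_via ::
    "('a \<Rightarrow> 'm) \<Rightarrow> ('m, 'b) monoid_scheme \<Rightarrow> 'a set \<Rightarrow> ('a list \<times> 'a list) set \<Rightarrow> bool" where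
  "defined_by_presentation_via \<phi> M A R \<longleftrightarrow>
     R \<subseteq> lists A \<times> lists A \<and> \<phi> \<in> A \<rightarrow> carrier M \<and>
     (\<exists>f \<in> iso (presented_monoid A R) M. \<forall>a\<in>A. f (presented_congruence A R `` {[a]}) = \<phi> a)"

lemma monoid_free_monoid: "monoid (free_monoid A)"
  by unfold_locales (auto simp: free_monoid_def)

lemma congruence_on_generated:
  assumes "monoid M" "R \<subseteq> carrier M \<times> carrier M"
  shows "congruence_on M (generated_congruence M R)"
proof -
  interpret monoid M by fact
  let ?S = "{\<rho>. congruence_on M \<rho> \<and> R \<subseteq> \<rho>}"
  have top: "carrier M \<times> carrier M \<in> ?S"
    using assms(2) by (auto simp: congruence_on_def equiv_def refl_on_def sym_def trans_def)
  have "equiv (carrier M) (\<Inter> ?S)"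
  proof (rule equivI)
    show "\<Inter> ?S \<subseteq> carrier M \<times> carrier M" using top by blast
    show "refl_on (carrier M) (\<Inter> ?S)"
      by (auto simp: congruence_on_def equiv_def refl_on_def)
    have "sym \<rho>" if "\<rho> \<in> ?S" for \<rho>
      using that by (simp add: congruence_on_def equiv_def)
    then show "sym (\<Inter> ?S)" by (meson Inter_iff symD symI)
    have trans: "trans \<rho>" if "\<rho> \<in> ?S" for \<rho>
      using that by (simp add: congruence_on_def equiv_def)
    show "trans (\<Inter> ?S)"
    proof (intro transI InterI)
      fix a b c \<rho>
      assume "(a, b) \<in> \<Inter> ?S" "(b, c) \<in> \<Inter> ?S" "\<rho> \<in> ?S"
      then have "(a, b) \<in> \<rho>" "(b, c) \<in> \<rho>" "trans \<rho>" using trans by (fast, fast, blast)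
      then show "(a, c) \<in> \<rho>" by (metis transD)
    qed
  qed
  moreover have "(a \<otimes>\<^bsub>M\<^esub> c, b \<otimes>\<^bsub>M\<^esub> d) \<in> \<Inter> ?S"
    if "(a, b) \<in> \<Inter> ?S" "(c, d) \<in> \<Inter> ?S" for a b c d
  proof (rule InterI)
    fix \<rho> assume \<rho>: "\<rho> \<in> ?S"
    have "(a, b) \<in> \<rho>" using that(1) \<rho> by (rule InterD)
    moreover have "(c, d) \<in> \<rho>" using that(2) \<rho> by (rule InterD)
    moreover have "\<forall>(a, b) \<in> \<rho>. \<forall>(c, d) \<in> \<rho>. (a \<otimes>\<^bsub>M\<^esub> c, b \<otimes>\<^bsub>M\<^esub> d) \<in> \<rho>"
      using \<rho> by (simp add: congruence_on_def)
    ultimately show "(a \<otimes>\<^bsub>M\<^esub> c, b \<otimes>\<^bsub>M\<^esub> d) \<in> \<rho>" by fastforce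
  qed
  ultimately show ?thesis
    unfolding generated_congruence_def by (subst congruence_on_def) blast
qed

lemma quotient_monoid_mult:
  assumes "congruence_on M \<rho>" "a \<in> carrier M" "b \<in> carrier M"
  shows "\<rho> `` {a} \<otimes>\<^bsub>quotient_monoid M \<rho>\<^esub> \<rho> `` {b} = \<rho> `` {a \<otimes>\<^bsub>M\<^esub> b}"
proof -
  have eq: "equiv (carrier M) \<rho>" using assms(1) by (simp add: congruence_on_def)
  have ne: "a \<in> \<rho> `` {a}" "b \<in> \<rho> `` {b}"
    using eq assms(2,3) by (auto simp: equiv_def refl_on_def)
  have same: "\<rho> `` {a' \<otimes>\<^bsub>M\<^esub> b'} = \<rho> `` {a \<otimes>\<^bsub>M\<^esub> b}" if "(a, a') \<in> \<rho>" "(b, b') \<in> \<rho>" for a' b'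
  proof -
    have "(a \<otimes>\<^bsub>M\<^esub> b, a' \<otimes>\<^bsub>M\<^esub> b') \<in> \<rho>"
      using assms(1) that unfolding congruence_on_def by fast
    then show ?thesis using equiv_class_eq[OF eq] by metis
  qed
  have "(\<Union>a'\<in>\<rho> `` {a}. \<Union>b'\<in>\<rho> `` {b}. \<rho> `` {a' \<otimes>\<^bsub>M\<^esub> b'}) =
      (\<Union>a'\<in>\<rho> `` {a}. \<Union>b'\<in>\<rho> `` {b}. \<rho> `` {a \<otimes>\<^bsub>M\<^esub> b})"
    by (intro SUP_cong refl same) simp_all
  also have "\<dots> = \<rho> `` {a \<otimes>\<^bsub>M\<^esub> b}" using ne by blast
  finally show ?thesis by (simp add: quotient_monoid_def)
qed

section \<open>Partial isometries of the cycle graph\<close>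

definition cycle_edges :: "nat \<Rightarrow> (nat \<times> nat) set" where
  "cycle_edges n =
     {(x, y). \<exists>i. 1 \<le> i \<and> i + 1 \<le> n \<and> {x, y} = {i, i + 1}} \<union> {(1, n), (n, 1)}"

definition cycle_dist :: "nat \<Rightarrow> nat \<Rightarrow> nat \<Rightarrow> int" where
  "cycle_dist n x y = min \<bar>int x - int y\<bar> (int n - \<bar>int x - int y\<bar>)"

lemma cycle_edges_iff:
  "(x, y) \<in> cycle_edges n \<longleftrightarrow>
     1 \<le> x \<and> y = x + 1 \<and> y \<le> n \<or> 1 \<le> y \<and> x = y + 1 \<and> x \<le> n \<or> x = 1 \<and> y = n \<or> x = n \<and> y = 1"
  unfolding cycle_edges_def by (auto simp: doubleton_eq_iff)

lemma cycle_dist_le_walk: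
  assumes "3 \<le> n" "x \<in> {1..n}" "(x, y) \<in> cycle_edges n ^^ k"
  shows "y \<in> {1..n} \<and> cycle_dist n x y \<le> int k"
  using assms(3)
proof (induction k arbitrary: y)
  case 0
  then show ?case using assms(2) by (auto simp: cycle_dist_def)
next
  case (Suc k)
  then obtain z where z: "(x, z) \<in> cycle_edges n ^^ k" "(z, y) \<in> cycle_edges n" by auto
  have "z \<in> {1..n}" "cycle_dist n x z \<le> int k" using Suc.IH[OF z(1)] by auto
  with z(2) assms(1,2) show ?case
    unfolding cycle_edges_iff cycle_dist_def atLeastAtMost_iff
    by (elim disjE) (auto simp: min_def abs_if split: if_splits)
qed

lemma cycle_walk:
  assumes "3 \<le> n" "x \<in> {1..n}" "y \<in> {1..n}" "cycle_dist n x y = int k"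
  shows "(x, y) \<in> cycle_edges n ^^ k"
  using assms(3,4)
proof (induction k arbitrary: y)
  case 0
  then show ?case using assms(1,2) by (auto simp: cycle_dist_def split: if_splits)
next
  case (Suc k)
  have "\<exists>z \<in> {1..n}. (z, y) \<in> cycle_edges n \<and> cycle_dist n x z = int k"
  proof -
    let ?p = "if y = 1 then n else y - 1" and ?s = "if y = n then 1 else y + 1"
    have "?p \<in> {1..n}" "?s \<in> {1..n}" "(?p, y) \<in> cycle_edges n" "(?s, y) \<in> cycle_edges n"
      using Suc.prems(1) assms(1) by (auto simp: cycle_edges_iff)
    moreover have "cycle_dist n x ?p = int k \<or> cycle_dist n x ?s = int k"
      using Suc.prems assms(1,2) unfolding cycle_dist_def atLeastAtMost_iff
      by (auto simp: min_def abs_if of_nat_diff split: if_splits)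
    ultimately show ?thesis by blast
  qed
  then show ?case using Suc.IH by (meson relpow_Suc_I)
qed

lemma cycle_dist_geodesic:
  assumes "3 \<le> n" "x \<in> {1..n}" "y \<in> {1..n}"
  shows "cycle_dist n x y = int (LEAST k. (x, y) \<in> cycle_edges n ^^ k)"
proof -
  have "0 \<le> cycle_dist n x y" using assms by (auto simp: cycle_dist_def)
  then obtain k where k: "cycle_dist n x y = int k" using nonneg_int_cases by blast
  have "(LEAST k. (x, y) \<in> cycle_edges n ^^ k) = k"
  proof (rule Least_equality)
    show "(x, y) \<in> cycle_edges n ^^ k" using cycle_walk assms k by blast
    show "k \<le> m" if "(x, y) \<in> cycle_edges n ^^ m" for m
      using cycle_dist_le_walk[OF assms(1,2) that] k by simp
  qed
  with k show ?thesis by simp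
qed

definition partial_isometry :: "nat \<Rightarrow> (nat \<rightharpoonup> nat) \<Rightarrow> bool" where
  "partial_isometry n \<alpha> \<longleftrightarrow> dom \<alpha> \<subseteq> {1..n} \<and> ran \<alpha> \<subseteq> {1..n} \<and>
     (\<forall>x \<in> dom \<alpha>. \<forall>y \<in> dom \<alpha>. cycle_dist n (the (\<alpha> x)) (the (\<alpha> y)) = cycle_dist n x y)"

lemma partial_isometry_iff:
  "partial_isometry n \<alpha> \<longleftrightarrow>
     (\<forall>x x'. \<alpha> x = Some x' \<longrightarrow> x \<in> {1..n} \<and> x' \<in> {1..n}) \<and>
     (\<forall>x x' y y'. \<alpha> x = Some x' \<longrightarrow> \<alpha> y = Some y' \<longrightarrow> cycle_dist n x' y' = cycle_dist n x y)"
proof -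
  have "(\<forall>x \<in> dom \<alpha>. \<forall>y \<in> dom \<alpha>. cycle_dist n (the (\<alpha> x)) (the (\<alpha> y)) = cycle_dist n x y) \<longleftrightarrow>
      (\<forall>x x' y y'. \<alpha> x = Some x' \<longrightarrow> \<alpha> y = Some y' \<longrightarrow> cycle_dist n x' y' = cycle_dist n x y)"
    by (force simp: dom_def)
  then show ?thesis unfolding partial_isometry_def dom_def ran_def by blast
qed

text \<open>
  Maps act on the right, so the product \<open>\<alpha>\<beta>\<close> applies \<open>\<alpha>\<close> first.
\<close>

definition DPC :: "nat \<Rightarrow> (nat \<rightharpoonup> nat) monoid" where
  "DPC n = \<lparr>carrier = {\<alpha>. partial_isometry n \<alpha>},
            monoid.mult = (\<lambda>\<alpha> \<beta>. \<beta> \<circ>\<^sub>m \<alpha>),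
            one = Some |` {1..n}\<rparr>"

lemma monoid_DPC: "monoid (DPC n)"
proof
  fix \<alpha> \<beta> \<gamma>
  show "\<alpha> \<otimes>\<^bsub>DPC n\<^esub> \<beta> \<otimes>\<^bsub>DPC n\<^esub> \<gamma> = \<alpha> \<otimes>\<^bsub>DPC n\<^esub> (\<beta> \<otimes>\<^bsub>DPC n\<^esub> \<gamma>)"
    by (auto simp: DPC_def map_comp_def split: option.splits)
  show "\<one>\<^bsub>DPC n\<^esub> \<in> carrier (DPC n)"
    by (auto simp: DPC_def partial_isometry_def ran_def restrict_map_def split: if_splits)
  assume a: "\<alpha> \<in> carrier (DPC n)"
  then have da: "dom \<alpha> \<subseteq> {1..n}" "ran \<alpha> \<subseteq> {1..n}" by (auto simp: DPC_def partial_isometry_def)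
  show "\<one>\<^bsub>DPC n\<^esub> \<otimes>\<^bsub>DPC n\<^esub> \<alpha> = \<alpha>"
  proof
    fix x show "(\<one>\<^bsub>DPC n\<^esub> \<otimes>\<^bsub>DPC n\<^esub> \<alpha>) x = \<alpha> x"
    proof (cases "x \<in> {1..n}")
      case False
      then have "\<alpha> x = None" using da(1) by blast
      then show ?thesis using False by (simp add: DPC_def)
    qed (simp add: DPC_def)
  qed
  show "\<alpha> \<otimes>\<^bsub>DPC n\<^esub> \<one>\<^bsub>DPC n\<^esub> = \<alpha>"
  proof
    fix x show "(\<alpha> \<otimes>\<^bsub>DPC n\<^esub> \<one>\<^bsub>DPC n\<^esub>) x = \<alpha> x"
    proof (cases "\<alpha> x")
      case (Some y)
      then have "y \<in> {1..n}" using da(2) by (auto simp: ran_def)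
      then show ?thesis using Some by (simp add: DPC_def)
    qed (simp add: DPC_def)
  qed
  assume b: "\<beta> \<in> carrier (DPC n)"
  show "\<alpha> \<otimes>\<^bsub>DPC n\<^esub> \<beta> \<in> carrier (DPC n)"
  proof -
    have *: "partial_isometry n \<alpha>" "partial_isometry n \<beta>" using a b by (simp_all add: DPC_def)
    have dist: "cycle_dist n x' y' = cycle_dist n x y"
      if "\<gamma> x = Some x'" "\<gamma> y = Some y'" "partial_isometry n \<gamma>" for \<gamma> x x' y y'
      using that by (simp add: partial_isometry_iff)
    have "partial_isometry n (\<beta> \<circ>\<^sub>m \<alpha>)"
      unfolding partial_isometry_iff[of n "\<beta> \<circ>\<^sub>m \<alpha>"] map_comp_Some_iff
    proof (intro conjI[rotated] allI impI; elim exE conjE)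
      fix x x' y y' u v
      assume "\<alpha> x = Some u" "\<beta> u = Some x'" "\<alpha> y = Some v" "\<beta> v = Some y'"
      then show "cycle_dist n x' y' = cycle_dist n x y" using dist * by metis
    qed (use * in \<open>auto simp: partial_isometry_def dom_def ran_def\<close>)
    then show ?thesis by (simp add: DPC_def)
  qed
qed

section \<open>The presentation\<close>

datatype letter = G | H | E nat

definition letters :: "nat \<Rightarrow> letter set" where
  "letters n = {G, H} \<union> E ` {1..n}"

lemma card_letters: "card (letters n) = n + 2"
proof -
  have "card (E ` {1..n}) = n" by (subst card_image) (auto simp: inj_on_def)
  then show ?thesis unfolding letters_def by (subst card_Un_disjoint) auto
qed

fun letter_map :: "nat \<Rightarrow> letter \<Rightarrow> (nat \<rightharpoonup> nat)" where
  "letter_map n G = (\<lambda>i. if i \<in> {1..n} then Some (if i < n then i + 1 else 1) else None)"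
| "letter_map n H = (\<lambda>i. if i \<in> {1..n} then Some (n + 1 - i) else None)"
| "letter_map n (E j) = Some |` ({1..n} - {j})"

lemma letter_map_in_DPC: "letter_map n a \<in> carrier (DPC n)"
proof -
  have eqI: "cycle_dist n x' y' = cycle_dist n x y"
    if "\<bar>int x' - int y'\<bar> = \<bar>int x - int y\<bar> \<or> \<bar>int x' - int y'\<bar> = int n - \<bar>int x - int y\<bar>"
    for x y x' y'
    using that by (auto simp: cycle_dist_def)
  have "partial_isometry n (letter_map n a)"
  proof (cases a)
    case G
    then show ?thesis by (auto simp: partial_isometry_iff split: if_splits intro!: eqI)
  next
    case H
    then show ?thesis by (auto simp: partial_isometry_iff of_nat_diff split: if_splits intro!: eqI)
  next
    case (E j)
    then show ?thesis by (auto simp: partial_isometry_iff restrict_map_def split: if_splits)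
  qed
  then show ?thesis by (simp add: DPC_def)
qed

definition e_word :: "nat list \<Rightarrow> letter list" where
  "e_word js = map E js"

definition R1 :: "nat \<Rightarrow> (letter list \<times> letter list) set" where
  "R1 n = {(replicate n G, []), ([H, H], []), ([H, G], replicate (n - 1) G @ [H])}"

definition R2 :: "nat \<Rightarrow> (letter list \<times> letter list) set" where
  "R2 n = {([E i, E i], [E i]) | i. 1 \<le> i \<and> i \<le> n}"

definition R3 :: "nat \<Rightarrow> (letter list \<times> letter list) set" where
  "R3 n = {([E i, E j], [E j, E i]) | i j. 1 \<le> i \<and> i < j \<and> j \<le> n}"

definition R4 :: "nat \<Rightarrow> (letter list \<times> letter list) set" where
  "R4 n = {([G, E 1], [E n, G])} \<union> {([G, E (i + 1)], [E i, G]) | i. 1 \<le> i \<and> i \<le> n - 1}"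

definition R5 :: "nat \<Rightarrow> (letter list \<times> letter list) set" where
  "R5 n = {([H, E i], [E (n - i + 1), H]) | i. 1 \<le> i \<and> i \<le> n}"

definition R6_odd :: "nat \<Rightarrow> (letter list \<times> letter list) set" where
  "R6_odd n = {([H, G] @ e_word [2..<n + 1], e_word [2..<n + 1])}"

definition R6_even :: "nat \<Rightarrow> (letter list \<times> letter list) set" where
  "R6_even n =
     {([H, G] @ e_word ([2..<n div 2 + 1] @ [n div 2 + 2..<n + 1]),
       e_word ([2..<n div 2 + 1] @ [n div 2 + 2..<n + 1])),
      ([H] @ e_word [1..<n + 1], e_word [1..<n + 1])}"

definition relations :: "nat \<Rightarrow> (letter list \<times> letter list) set" where
  "relations n = R1 n \<union> R2 n \<union> R3 n \<union> R4 n \<union> R5 n \<union> (if odd n then R6_odd n else R6_even n)"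

end

theory Submission
  imports Defs
begin

text \<open>
  Modulo the relations, every word reduces to a dihedral word followed by a product of the
  idempotents \<open>e\<^sub>i\<close> with \<open>i\<close> in a set \<open>X\<close>. The induced partial permutation determines \<open>X\<close>, the
  complement of its image, and determines the dihedral part up to the pointwise stabilizer of that
  complement. A nontrivial stabilizer arises only if the complement lies in the set of at most two
  points fixed by a reflection; conjugates of \<open>R\<^sub>6\<close> then absorb the stabilizer into the idempotents.
  Conversely, all partial isometries are restrictions of dihedral permutations: modulo \<open>n\<close>, a
  partial isometry changes each difference by a sign, and the signs can be chosen uniformly.
\<close>

section \<open>Words modulo a set of relations\<close>

text \<open>
  Words over the whole letter type are related, so that no membership conditions arise when rewriting.
\<close>

inductive word_equiv :: "('a list \<times> 'a list) set \<Rightarrow> 'a list \<Rightarrow> 'a list \<Rightarrow> bool" for R where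
  base: "(l, r) \<in> R \<Longrightarrow> word_equiv R l r"
| refl: "word_equiv R u u"
| sym: "word_equiv R u v \<Longrightarrow> word_equiv R v u"
| trans [trans]: "word_equiv R u v \<Longrightarrow> word_equiv R v w \<Longrightarrow> word_equiv R u w"
| append: "word_equiv R u u' \<Longrightarrow> word_equiv R v v' \<Longrightarrow> word_equiv R (u @ v) (u' @ v')"

lemma word_equiv_context: "word_equiv R u v \<Longrightarrow> word_equiv R (p @ u @ q) (p @ v @ q)"
  by (intro word_equiv.append word_equiv.refl)

lemma congruence_on_presented:
  assumes "R \<subseteq> lists A \<times> lists A"
  shows "congruence_on (free_monoid A) (presented_congruence A R)"
  unfolding presented_congruence_def
  by (rule congruence_on_generated[OF monoid_free_monoid]) (use assms in \<open>simp add: free_monoid_def\<close>)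

text \<open>A concatenation is a word over \<open>A\<close> exactly when both factors are, so a
  derivation cannot leave \<open>lists A\<close>; this covers the intermediate word of a
  transitivity step.\<close>

lemma word_equiv_lists_iff:
  assumes "R \<subseteq> lists A \<times> lists A" "word_equiv R u v"
  shows "u \<in> lists A \<longleftrightarrow> v \<in> lists A"
  using assms(2) by induction (use assms(1) in auto)

lemma word_equiv_imp_presented:
  assumes R: "R \<subseteq> lists A \<times> lists A" and "word_equiv R u v" "u \<in> lists A"
  shows "(u, v) \<in> presented_congruence A R"
  using assms(2,3)
proof induction
  case (base l r)
  then show ?case by (auto simp: presented_congruence_def generated_congruence_def)
next
  case (refl u)
  then show ?case
    using congruence_on_presented[OF R]
    by (auto simp: congruence_on_def equiv_def refl_on_def free_monoid_def)
next
  case (sym u v)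
  then have "(u, v) \<in> presented_congruence A R" using word_equiv_lists_iff[OF R] by blast
  then show ?case
    using congruence_on_presented[OF R] by (auto simp: congruence_on_def equiv_def dest: symD)
next
  case (trans u v w)
  then have "(u, v) \<in> presented_congruence A R" "(v, w) \<in> presented_congruence A R"
    using word_equiv_lists_iff[OF R] by blast+
  then show ?case
    using congruence_on_presented[OF R] unfolding congruence_on_def equiv_def by (meson transD)
next
  case (append u u' v v')
  then have "(u, u') \<in> presented_congruence A R" "(v, v') \<in> presented_congruence A R" by auto
  then show ?case
    using congruence_on_presented[OF R] unfolding congruence_on_def free_monoid_def by fastforce
qed

definition word_eval :: "('m, 'b) monoid_scheme \<Rightarrow> ('a \<Rightarrow> 'm) \<Rightarrow> 'a list \<Rightarrow> 'm" where
  "word_eval M \<phi> w = foldr (\<lambda>a m. \<phi> a \<otimes>\<^bsub>M\<^esub> m) w \<one>\<^bsub>M\<^esub>"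

lemma word_eval_simps [simp]:
  "word_eval M \<phi> [] = \<one>\<^bsub>M\<^esub>"
  "word_eval M \<phi> (a # w) = \<phi> a \<otimes>\<^bsub>M\<^esub> word_eval M \<phi> w"
  by (simp_all add: word_eval_def)

context monoid
begin

lemma word_eval_closed: "\<phi> \<in> A \<rightarrow> carrier G \<Longrightarrow> w \<in> lists A \<Longrightarrow> word_eval G \<phi> w \<in> carrier G"
  by (induction w) auto

lemma word_eval_append:
  assumes "\<phi> \<in> A \<rightarrow> carrier G" "u \<in> lists A" "v \<in> lists A"
  shows "word_eval G \<phi> (u @ v) = word_eval G \<phi> u \<otimes> word_eval G \<phi> v"
  using assms(2)
proof (induction u)
  case Nil
  then show ?case using word_eval_closed[OF assms(1,3)] by simp
next
  case (Cons a u)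
  then show ?case
    using word_eval_closed[OF assms(1)] assms by (auto simp: m_assoc Pi_iff)
qed

text \<open>By soundness the kernel of evaluation is one of the congruences being intersected, which
  gives one inclusion. Completeness derives every pair of the kernel, which gives the other.\<close>

lemma presented_congruence_eq_kernel:
  assumes \<phi>: "\<phi> \<in> A \<rightarrow> carrier G" and R: "R \<subseteq> lists A \<times> lists A"
    and sound: "\<And>l r. (l, r) \<in> R \<Longrightarrow> word_eval G \<phi> l = word_eval G \<phi> r"
    and complete: "\<And>u v. u \<in> lists A \<Longrightarrow> v \<in> lists A \<Longrightarrow>
      word_eval G \<phi> u = word_eval G \<phi> v \<Longrightarrow> word_equiv R u v"
  shows "presented_congruence A R =
    {(u, v). u \<in> lists A \<and> v \<in> lists A \<and> word_eval G \<phi> u = word_eval G \<phi> v}" (is "_ = ?K")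
proof
  have "congruence_on (free_monoid A) ?K"
    unfolding congruence_on_def equiv_def
    by (auto simp: free_monoid_def refl_on_def sym_def trans_def word_eval_append[OF \<phi>])
  then show "presented_congruence A R \<subseteq> ?K"
    using R sound unfolding presented_congruence_def generated_congruence_def by blast
  show "?K \<subseteq> presented_congruence A R"
    using complete word_equiv_imp_presented[OF R] by blast
qed

lemma defined_by_presentationI:
  assumes \<phi>: "\<phi> \<in> A \<rightarrow> carrier G" and R: "R \<subseteq> lists A \<times> lists A"
    and sound: "\<And>l r. (l, r) \<in> R \<Longrightarrow> word_eval G \<phi> l = word_eval G \<phi> r"
    and complete: "\<And>u v. u \<in> lists A \<Longrightarrow> v \<in> lists A \<Longrightarrow>
      word_eval G \<phi> u = word_eval G \<phi> v \<Longrightarrow> word_equiv R u v"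
    and onto: "\<And>x. x \<in> carrier G \<Longrightarrow> \<exists>w \<in> lists A. word_eval G \<phi> w = x"
  shows "defined_by_presentation G A R \<and> defined_by_presentation_via \<phi> G A R"
proof -
  let ?\<rho> = "presented_congruence A R" and ?P = "presented_monoid A R"
  have \<rho>: "?\<rho> = {(u, v). u \<in> lists A \<and> v \<in> lists A \<and> word_eval G \<phi> u = word_eval G \<phi> v}"
    using presented_congruence_eq_kernel[OF \<phi> R sound complete] by blast
  \<comment> \<open>The congruence classes are the fibres of evaluation; \<open>f\<close> reads off
    the single value taken on a fibre and so inverts \<open>fib\<close>.\<close>
  define fib where "fib x = {w \<in> lists A. word_eval G \<phi> w = x}" for x
  define f where "f X = the_elem (word_eval G \<phi> ` X)" for X
  have cls: "?\<rho> `` {w} = fib (word_eval G \<phi> w)" if "w \<in> lists A" for w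
    using that by (auto simp: \<rho> fib_def)
  have f_fib: "f (fib x) = x" if "x \<in> carrier G" for x
  proof -
    have "word_eval G \<phi> ` fib x = {x}" using onto[OF that] by (auto simp: fib_def)
    then show ?thesis by (simp add: f_def)
  qed
  have carr: "carrier ?P = fib ` carrier G"
  proof -
    have "carrier ?P = (\<lambda>w. ?\<rho> `` {w}) ` lists A"
      by (auto simp: presented_monoid_def quotient_monoid_def quotient_def free_monoid_def)
    also have "\<dots> = fib ` word_eval G \<phi> ` lists A" using cls by (auto simp: image_def)
    also have "word_eval G \<phi> ` lists A = carrier G" using onto word_eval_closed[OF \<phi>] by blast
    finally show ?thesis .
  qed
  have mult: "fib x \<otimes>\<^bsub>?P\<^esub> fib y = fib (x \<otimes> y)" if xy: "x \<in> carrier G" "y \<in> carrier G" for x y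
  proof -
    obtain u v where uv: "u \<in> lists A" "v \<in> lists A" "word_eval G \<phi> u = x" "word_eval G \<phi> v = y"
      using onto[OF xy(1)] onto[OF xy(2)] by blast
    have "?\<rho> `` {u} \<otimes>\<^bsub>?P\<^esub> ?\<rho> `` {v} = ?\<rho> `` {u \<otimes>\<^bsub>free_monoid A\<^esub> v}"
      unfolding presented_monoid_def
      using quotient_monoid_mult[OF congruence_on_presented[OF R]] uv by (simp add: free_monoid_def)
    then show ?thesis
      using uv cls[of u] cls[of v] cls[of "u @ v"] word_eval_append[OF \<phi>]
      by (simp add: free_monoid_def)
  qed
  have inj: "inj_on fib (carrier G)" by (metis f_fib inj_onI)
  have "fib \<in> iso G ?P"
    using mult inj by (auto simp: iso_def hom_def bij_betw_def carr)
  moreover have "f \<in> iso ?P G"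
  proof -
    have "bij_betw f (carrier ?P) (carrier G)"
      by (intro bij_betwI[where g = fib]) (auto simp: carr f_fib)
    then show ?thesis using mult by (auto simp: iso_def hom_def carr f_fib)
  qed
  moreover have "f (?\<rho> `` {[a]}) = \<phi> a" if "a \<in> A" for a
    using that cls[of "[a]"] \<phi> f_fib by (auto simp: Pi_iff)
  ultimately show ?thesis
    using \<phi> R unfolding defined_by_presentation_def defined_by_presentation_via_def is_iso_def
    by blast
qed

end

section \<open>The dihedral action on the cycle\<close>

locale cycle =
  fixes n :: nat
  assumes n_ge_3: "n \<ge> 3"
begin

text \<open>The representative in \<open>{1..n}\<close> of \<open>s x + k\<close> modulo \<open>n\<close>.\<close>

definition act :: "int \<Rightarrow> int \<Rightarrow> nat \<Rightarrow> nat" where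
  "act s k x = nat ((s * int x + k - 1) mod int n) + 1"

lemma act_in: "act s k x \<in> {1..n}"
proof -
  have "nat ((s * int x + k - 1) mod int n) < n" using n_ge_3 by (simp add: nat_less_iff)
  then show ?thesis unfolding act_def by simp
qed

lemma act_dvd: "int n dvd s * int x + k - int (act s k x)"
proof -
  have "int (act s k x) = (s * int x + k - 1) mod int n + 1"
    using n_ge_3 unfolding act_def by simp
  then have "s * int x + k - int (act s k x) = (s * int x + k - 1) - (s * int x + k - 1) mod int n"
    by simp
  then show ?thesis by (metis dvd_minus_mod)
qed

lemma dvd_diff_imp_eq:
  assumes "x \<in> {1..n}" "y \<in> {1..n}" "int n dvd int x - int y"
  shows "x = y"
proof (rule ccontr)
  assume "x \<noteq> y"
  then have "\<bar>int n\<bar> \<le> \<bar>int x - int y\<bar>" using assms(3) by (intro dvd_imp_le_int) auto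
  then show False using assms(1,2) by auto
qed

text \<open>Each residue modulo \<open>n\<close> has only one representative in
  \<open>{1..n}\<close>, so equations between points of the cycle turn into divisibility
  statements.\<close>

lemma act_eq_iff:
  assumes "y \<in> {1..n}"
  shows "act s k x = y \<longleftrightarrow> int n dvd s * int x + k - int y"
proof
  assume "int n dvd s * int x + k - int y"
  then have "int n dvd (s * int x + k - int y) - (s * int x + k - int (act s k x))"
    using act_dvd by (rule dvd_diff)
  then show "act s k x = y" using dvd_diff_imp_eq[OF act_in assms] by simp
qed (use act_dvd in blast)

lemma act_act: "act s' k' (act s k x) = act (s' * s) (s' * k + k') x"
proof -
  let ?y = "act (s' * s) (s' * k + k') x"
  have "int n dvd (s' * s * int x + (s' * k + k') - int ?y) - s' * (s * int x + k - int (act s k x))"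
    by (intro dvd_diff dvd_mult act_dvd)
  also have "\<dots> = s' * int (act s k x) + k' - int ?y" by (simp add: algebra_simps)
  finally show ?thesis using act_eq_iff act_in by blast
qed

lemma act_mod: "k mod int n = k' mod int n \<Longrightarrow> act s k x = act s k' x"
  unfolding act_def by (metis mod_add_right_eq mod_diff_left_eq)

lemma act_1_0: "x \<in> {1..n} \<Longrightarrow> act 1 0 x = x"
  by (simp add: act_eq_iff)

lemma act_G: "x \<in> {1..n} \<Longrightarrow> act 1 1 x = (if x < n then x + 1 else 1)"
  by (subst act_eq_iff) auto

lemma act_H: "x \<in> {1..n} \<Longrightarrow> act (-1) 1 x = n + 1 - x"
  by (subst act_eq_iff) (auto simp: of_nat_diff)

lemma act_inj:
  assumes "s \<in> {1, -1}" "x \<in> {1..n}" "y \<in> {1..n}" "act s k x = act s k y"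
  shows "x = y"
proof -
  have "act s (- s * k) (act s k z) = z" if "z \<in> {1..n}" for z
    using assms(1) act_1_0[OF that] by (auto simp: act_act)
  then show ?thesis using assms by metis
qed

section \<open>Rewriting words to a normal form\<close>

abbreviation equiv :: "letter list \<Rightarrow> letter list \<Rightarrow> bool" (infix "\<approx>" 50) where
  "u \<approx> v \<equiv> word_equiv (relations n) u v"

lemmas equiv_refl = word_equiv.refl[of "relations n"]
lemmas equiv_sym = word_equiv.sym[of "relations n"]
lemmas equiv_context = word_equiv_context[of "relations n"]

lemma equiv_left: "u \<approx> v \<Longrightarrow> p @ u \<approx> p @ v"
  using equiv_context[of u v p "[]"] by simp

lemma equiv_right: "u \<approx> v \<Longrightarrow> u @ q \<approx> v @ q"
  using equiv_context[of u v "[]" q] by simp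

section \<open>Dihedral words and their multiplication\<close>

definition rot :: "int \<Rightarrow> letter list" where
  "rot k = replicate (nat (k mod int n)) G"

text \<open>The word \<open>dih s k\<close>, for \<open>s = 1\<close> or \<open>s = -1\<close>, represents the permutation \<open>act s k\<close>.\<close>

definition dih :: "int \<Rightarrow> int \<Rightarrow> letter list" where
  "dih s k = (if s = 1 then rot k else H # rot (k - 1))"

lemma rot_cong: "k mod int n = k' mod int n \<Longrightarrow> rot k = rot k'"
  by (simp add: rot_def)

lemma rot_0: "rot 0 = []" and rot_1: "rot 1 = [G]"
  using n_ge_3 by (simp_all add: rot_def)

text \<open>On the cycle \<open>H\<close> is x -> 1 - x modulo \<open>n\<close>, whence the shift by
  1 in \<open>dih\<close>. \<open>H\<close> followed by \<open>G\<close> is x -> 2 - x, the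
  reflection fixing the point 1.\<close>

lemma dih_H: "dih (-1) 1 = [H]" and dih_G: "dih 1 1 = [G]" and dih_HG: "dih (-1) 2 = [H, G]"
  by (simp_all add: dih_def rot_0 rot_1)

lemma dih_cong: "k mod int n = k' mod int n \<Longrightarrow> dih s k = dih s k'"
  unfolding dih_def by (metis rot_cong mod_diff_left_eq)

lemma rel_G: "replicate n G \<approx> []" and rel_HH: "[H, H] \<approx> []"
  and rel_HG: "[H, G] \<approx> replicate (n - 1) G @ [H]"
  by (rule word_equiv.base, simp add: relations_def R1_def)+

lemma replicate_G_equiv_rot: "replicate m G \<approx> rot (int m)"
proof -
  have "replicate (n * q) G \<approx> []" for q
  proof (induction q)
    case (Suc q)
    then show ?case using word_equiv.append[OF rel_G Suc] by (simp add: replicate_add)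
  qed (simp add: equiv_refl)
  from equiv_right[OF this, of "m div n" "replicate (m mod n) G"]
  show ?thesis by (simp add: rot_def flip: replicate_add of_nat_mod)
qed

lemma rot_rot: "rot a @ rot b \<approx> rot (a + b)"
proof -
  have "rot (int (nat (a mod int n) + nat (b mod int n))) = rot (a + b)"
    using n_ge_3 by (intro rot_cong) (simp add: mod_add_eq)
  then show ?thesis
    using replicate_G_equiv_rot[of "nat (a mod int n) + nat (b mod int n)"]
    by (simp add: rot_def flip: replicate_add)
qed

lemma GH: "[G, H] \<approx> H # rot (-1)"
proof -
  have nat_n: "nat (- 1 mod int n) = n - 1"
    using n_ge_3 by (simp add: zmod_minus1 nat_diff_distrib)
  \<comment> \<open>Appending a full turn creates the factor \<open>HG\<close>, to which
    \<open>R1\<close> applies; the \<open>n\<close> copies of \<open>G\<close> then gathered on the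
    left cancel.\<close>
  have "[G, H] \<approx> [G, H] @ replicate n G"
    using equiv_left[OF equiv_sym[OF rel_G], of "[G, H]"] by simp
  also have "[G, H] @ replicate n G = [G] @ [H, G] @ replicate (n - 1) G"
    using n_ge_3 by (simp add: replicate_Suc[symmetric] del: replicate_Suc)
  also have "\<dots> \<approx> [G] @ (replicate (n - 1) G @ [H]) @ replicate (n - 1) G"
    by (rule equiv_context[OF rel_HG])
  also have "\<dots> = replicate n G @ [H] @ replicate (n - 1) G"
    using n_ge_3 by (cases n) simp_all
  also have "\<dots> \<approx> [] @ [H] @ replicate (n - 1) G" by (rule equiv_right[OF rel_G])
  finally show ?thesis by (simp add: rot_def nat_n)
qed

lemma rot_H: "rot k @ [H] \<approx> H # rot (- k)"
proof -
  have "replicate m G @ [H] \<approx> H # rot (- int m)" for m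
  proof (induction m)
    case (Suc m)
    have "replicate (Suc m) G @ [H] \<approx> [G] @ H # rot (- int m)"
      using equiv_left[OF Suc, of "[G]"] by simp
    also have "\<dots> \<approx> (H # rot (-1)) @ rot (- int m)"
      using equiv_right[OF GH, of "rot (- int m)"] by simp
    also have "\<dots> \<approx> H # rot (- 1 + - int m)"
      using equiv_left[OF rot_rot[of "- 1" "- int m"], of "[H]"] by simp
    finally show ?case by simp
  qed (simp add: rot_0 equiv_refl)
  from this[of "nat (k mod int n)"]
  have "rot k @ [H] \<approx> H # rot (- (k mod int n))" using n_ge_3 by (simp add: rot_def)
  also have "rot (- (k mod int n)) = rot (- k)" by (rule rot_cong) (rule mod_minus_eq)
  finally show ?thesis .
qed

lemma dih_rot: "dih s k @ rot j \<approx> dih s (k + j)"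
  using rot_rot[of k j] equiv_left[OF rot_rot[of "k - 1" j], of "[H]"]
  by (simp add: dih_def algebra_simps)

lemma dih_mult_H:
  assumes "s \<in> {1, -1}"
  shows "dih s k @ [H] \<approx> dih (- s) (1 - k)"
proof (cases "s = 1")
  case True
  then show ?thesis using rot_H[of k] by (simp add: dih_def)
next
  case False
  have "[H] @ rot (k - 1) @ [H] \<approx> [H, H] @ rot (1 - k)"
    using equiv_left[OF rot_H[of "k - 1"], of "[H]"] by simp
  also have "\<dots> \<approx> [] @ rot (1 - k)" by (rule equiv_right[OF rel_HH])
  finally show ?thesis using False assms by (simp add: dih_def)
qed

text \<open>The left factor acts first, so the product is x -> s' (s x + k) + k', the law of
  \<open>act_act\<close>. The essential step is that a rotation is inverted when \<open>H\<close>
  moves past it.\<close>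

lemma dih_dih:
  assumes "s \<in> {1, -1}" "s' \<in> {1, -1}"
  shows "dih s k @ dih s' k' \<approx> dih (s' * s) (s' * k + k')"
proof (cases "s' = 1")
  case True
  then show ?thesis using dih_rot[of s k k'] by (simp add: dih_def)
next
  case False
  have "(dih s k @ [H]) @ rot (k' - 1) \<approx> dih (- s) (1 - k) @ rot (k' - 1)"
    by (rule equiv_right[OF dih_mult_H[OF assms(1)]])
  also have "\<dots> \<approx> dih (- s) (1 - k + (k' - 1))" by (rule dih_rot)
  finally show ?thesis using False assms by (simp add: dih_def[of "- 1"] algebra_simps)
qed

section \<open>Sliding idempotent letters past dihedral words\<close>

lemma E_G:
  assumes "i \<in> {1..n}"
  shows "[E i] @ [G] \<approx> [G] @ [E (act 1 1 i)]"
proof (cases "i = n")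
  case True
  have "[G, E 1] \<approx> [E n, G]" by (rule word_equiv.base) (simp add: relations_def R4_def)
  then show ?thesis using act_G[OF assms] True by (simp add: equiv_sym)
next
  case False
  have "([G, E (i + 1)], [E i, G]) \<in> R4 n" using assms False by (auto simp: R4_def)
  then have "[G, E (i + 1)] \<approx> [E i, G]" by (intro word_equiv.base) (simp add: relations_def)
  then show ?thesis using act_G[OF assms] assms False by (simp add: equiv_sym)
qed

lemma E_H:
  assumes "i \<in> {1..n}"
  shows "[E i] @ [H] \<approx> [H] @ [E (act (-1) 1 i)]"
proof -
  \<comment> \<open>\<open>R5\<close> is used at the index \<open>n + 1 - i\<close>, whose mirror
    image is \<open>i\<close>.\<close>
  have "([H, E (n + 1 - i)], [E (n - (n + 1 - i) + 1), H]) \<in> R5 n"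
    unfolding R5_def using assms by (intro CollectI exI[of _ "n + 1 - i"]) auto
  moreover have "n - (n + 1 - i) + 1 = i" using assms by auto
  ultimately have "[H, E (n + 1 - i)] \<approx> [E i, H]"
    by (intro word_equiv.base) (simp add: relations_def)
  then show ?thesis using act_H[OF assms] by (simp add: equiv_sym)
qed

lemma E_rot:
  assumes "i \<in> {1..n}"
  shows "[E i] @ rot k \<approx> rot k @ [E (act 1 k i)]"
proof -
  have "[E i] @ replicate m G \<approx> replicate m G @ [E (act 1 (int m) i)]" for m
  proof (induction m)
    case (Suc m)
    have "[E i] @ replicate (Suc m) G = ([E i] @ replicate m G) @ [G]"
      by (simp add: replicate_append_same)
    also have "\<dots> \<approx> (replicate m G @ [E (act 1 (int m) i)]) @ [G]" by (rule equiv_right[OF Suc])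
    also have "\<dots> \<approx> replicate m G @ [G] @ [E (act 1 1 (act 1 (int m) i))]"
      using equiv_left[OF E_G[OF act_in]] by simp
    finally show ?case by (simp add: act_act replicate_app_Cons_same add.commute)
  qed (simp add: act_1_0[OF assms] equiv_refl)
  from this[of "nat (k mod int n)"] show ?thesis
    using n_ge_3 act_mod[of "k mod int n" k 1 i] by (simp add: rot_def)
qed

text \<open>Deleting \<open>i\<close> before a permutation amounts to deleting the image of
  \<open>i\<close> after it.\<close>

lemma E_dih:
  assumes "s \<in> {1, -1}" "i \<in> {1..n}"
  shows "[E i] @ dih s k \<approx> dih s k @ [E (act s k i)]"
proof (cases "s = 1")
  case True
  then show ?thesis using E_rot[OF assms(2)] by (simp add: dih_def)
next
  case False
  have "([E i] @ [H]) @ rot (k - 1) \<approx> ([H] @ [E (act (-1) 1 i)]) @ rot (k - 1)"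
    by (rule equiv_right[OF E_H[OF assms(2)]])
  also have "\<dots> \<approx> [H] @ rot (k - 1) @ [E (act 1 (k - 1) (act (-1) 1 i))]"
    using equiv_left[OF E_rot[OF act_in], of "[H]"] by simp
  finally show ?thesis using False assms(1) by (simp add: dih_def act_act)
qed

lemma e_word_Nil: "e_word [] = []" and e_word_Cons: "e_word (j # js) = E j # e_word js"
  by (simp_all add: e_word_def)

lemma e_word_dih:
  assumes "s \<in> {1, -1}" "set js \<subseteq> {1..n}"
  shows "e_word js @ dih s k \<approx> dih s k @ e_word (map (act s k) js)"
  using assms(2)
proof (induction js)
  case (Cons j js)
  have "e_word (j # js) @ dih s k \<approx> ([E j] @ dih s k) @ e_word (map (act s k) js)"
    using equiv_left[of _ _ "[E j]"] Cons by (simp add: e_word_Cons)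
  also have "\<dots> \<approx> (dih s k @ [E (act s k j)]) @ e_word (map (act s k) js)"
    using Cons.prems by (intro equiv_right E_dih assms(1)) simp
  finally show ?case by (simp add: e_word_Cons)
qed (simp add: e_word_Nil equiv_refl)

section \<open>Products of idempotents and the normal form\<close>

lemma E_idem: "i \<in> {1..n} \<Longrightarrow> [E i, E i] \<approx> [E i]"
  by (rule word_equiv.base) (auto simp: relations_def R2_def)

lemma E_comm:
  assumes "i \<in> {1..n}" "j \<in> {1..n}"
  shows "[E i, E j] \<approx> [E j, E i]"
proof -
  have "[E i, E j] \<approx> [E j, E i]" if "i < j" "i \<in> {1..n}" "j \<in> {1..n}" for i j
    using that by (intro word_equiv.base) (auto simp: relations_def R3_def)
  from this[of i j] this[of j i] show ?thesis
    using assms equiv_refl equiv_sym by (cases i j rule: linorder_cases) auto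
qed

lemma E_e_word_comm:
  assumes "i \<in> {1..n}" "set js \<subseteq> {1..n}"
  shows "[E i] @ e_word js \<approx> e_word js @ [E i]"
  using assms(2)
proof (induction js)
  case (Cons j js)
  have "[E i] @ e_word (j # js) \<approx> [E j] @ [E i] @ e_word js"
    using equiv_right[OF E_comm[of i j], of "e_word js"] Cons.prems assms(1)
    by (simp add: e_word_Cons)
  also have "\<dots> \<approx> [E j] @ e_word js @ [E i]"
    using Cons by (intro equiv_left) simp
  finally show ?case by (simp add: e_word_Cons)
qed (simp add: e_word_Nil equiv_refl)

lemma e_word_comm:
  assumes "set ks \<subseteq> {1..n}" "set js \<subseteq> {1..n}"
  shows "e_word ks @ e_word js \<approx> e_word js @ e_word ks"
  using assms(1)
proof (induction ks)
  case (Cons i ks)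
  have "e_word (i # ks) @ e_word js \<approx> ([E i] @ e_word js) @ e_word ks"
    using equiv_left[of _ _ "[E i]"] Cons by (simp add: e_word_Cons)
  also have "\<dots> \<approx> (e_word js @ [E i]) @ e_word ks"
    using Cons.prems assms(2) by (intro equiv_right E_e_word_comm) auto
  finally show ?case by (simp add: e_word_Cons)
qed (simp add: e_word_Nil equiv_refl)

lemma E_absorb:
  assumes "i \<in> set js" "set js \<subseteq> {1..n}"
  shows "[E i] @ e_word js \<approx> e_word js"
  using assms
proof (induction js)
  case (Cons j js)
  show ?case
  proof (cases "i = j")
    case True
    then show ?thesis
      using equiv_right[OF E_idem[of j], of "e_word js"] Cons.prems by (simp add: e_word_Cons)
  next
    case False
    have "[E i] @ e_word (j # js) \<approx> [E j] @ [E i] @ e_word js"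
      using equiv_right[OF E_comm[of i j], of "e_word js"] Cons.prems
      by (auto simp: e_word_Cons)
    also have "\<dots> \<approx> [E j] @ e_word js"
      using Cons False by (intro equiv_left) simp
    finally show ?thesis by (simp add: e_word_Cons)
  qed
qed simp

lemma e_word_absorb:
  assumes "set ks \<subseteq> set js" "set js \<subseteq> {1..n}"
  shows "e_word ks @ e_word js \<approx> e_word js"
  using assms(1)
proof (induction ks)
  case (Cons i ks)
  have "e_word (i # ks) @ e_word js \<approx> [E i] @ e_word js"
    using equiv_left[of _ _ "[E i]"] Cons by (simp add: e_word_Cons)
  also have "\<dots> \<approx> e_word js" using Cons.prems assms(2) by (intro E_absorb) auto
  finally show ?case .
qed (simp add: e_word_Nil equiv_refl)

text \<open>Two words with the same set of indices absorb each other and commute, so order and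
  multiplicity are irrelevant modulo the relations.\<close>

lemma e_word_eqI:
  assumes "set js = set ks" "set js \<subseteq> {1..n}"
  shows "e_word js \<approx> e_word ks"
proof -
  have "e_word js \<approx> e_word ks @ e_word js"
    using assms by (intro equiv_sym[OF e_word_absorb]) auto
  also have "\<dots> \<approx> e_word js @ e_word ks" using assms by (intro e_word_comm) auto
  also have "\<dots> \<approx> e_word ks" using assms by (intro e_word_absorb) auto
  finally show ?thesis .
qed

text \<open>Words are built by prepending letters: an idempotent slides through the dihedral word
  and joins the idempotents on the right, while \<open>G\<close> or \<open>H\<close> is multiplied
  into the dihedral word.\<close>

lemma normal_form:
  assumes "w \<in> lists (letters n)"
  shows "\<exists>s k js. s \<in> {1, -1} \<and> set js \<subseteq> {1..n} \<and> w \<approx> dih s k @ e_word js"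
  using assms
proof (induction w)
  case Nil
  show ?case
    by (rule exI[of _ 1], rule exI[of _ 0], rule exI[of _ "[]"])
       (simp add: dih_def rot_0 e_word_Nil equiv_refl)
next
  case (Cons a w)
  then obtain s k js where w: "s \<in> {1, -1}" "set js \<subseteq> {1..n}" "w \<approx> dih s k @ e_word js"
    by auto
  have aw: "a # w \<approx> ([a] @ dih s k) @ e_word js"
    using equiv_left[OF w(3), of "[a]"] by simp
  show ?case
  proof (cases "\<exists>i. a = E i")
    case True
    then obtain i where i: "a = E i" "i \<in> {1..n}" using Cons.hyps by (auto simp: letters_def)
    note aw
    also have "([a] @ dih s k) @ e_word js \<approx> (dih s k @ [E (act s k i)]) @ e_word js"
      unfolding i(1) by (rule equiv_right[OF E_dih[OF w(1) i(2)]])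
    also have "\<dots> = dih s k @ e_word (act s k i # js)" by (simp add: e_word_Cons)
    finally show ?thesis using w(1,2) act_in[of s k i]
      by (intro exI[of _ s] exI[of _ k] exI[of _ "act s k i # js"]) simp
  next
    case False
    \<comment> \<open>Both \<open>G\<close> and \<open>H\<close> are dihedral words with offset 1;
      they differ in the sign only.\<close>
    then obtain s' where s': "s' \<in> {1, -1}" "[a] = dih s' 1"
      using dih_G dih_H by (cases a) (metis insertCI)+
    note aw
    also have "([a] @ dih s k) @ e_word js \<approx> dih (s * s') (s * 1 + k) @ e_word js"
      unfolding s'(2) by (rule equiv_right[OF dih_dih[OF s'(1) w(1)]])
    finally show ?thesis using w(1,2) s'(1)
      by (intro exI[of _ "s * s'"] exI[of _ "s * 1 + k"] exI[of _ js]) auto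
  qed
qed

section \<open>Stabilizers\<close>

text \<open>The points moved by the reflection x -> 2 - x. It fixes 1 and, for even
  \<open>n\<close>, also n/2 + 1; these are the indices omitted in the relation of \<open>R6\<close>
  that begins with \<open>hg\<close>.\<close>

definition axis_list :: "nat list" where
  "axis_list = (if odd n then [2..<n + 1] else [2..<n div 2 + 1] @ [n div 2 + 2..<n + 1])"

lemma set_axis_list: "set axis_list = {y \<in> {1..n}. \<not> int n dvd 2 * (int y - 1)}"
proof -
  have key: "int n dvd 2 * (int y - 1) \<longleftrightarrow> y = 1 \<or> even n \<and> y = n div 2 + 1"
    if y: "y \<in> {1..n}" for y
  proof
    assume "int n dvd 2 * (int y - 1)"
    \<comment> \<open>Since 0 <= 2 (y - 1) < 2n, the quotient \<open>c\<close> can only be 0 or 1;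
      the value 1 gives the antipode of the point 1.\<close>
    then obtain c where c: "2 * (int y - 1) = int n * c" by (rule dvdE)
    have "0 \<le> int n * c" "int n * c < int n * 2" using y by (auto simp flip: c)
    then have "0 \<le> c" "c < 2" using n_ge_3 by (auto simp: zero_le_mult_iff)
    then have "c = 0 \<or> c = 1" by auto
    then show "y = 1 \<or> even n \<and> y = n div 2 + 1"
    proof
      assume "c = 1"
      then have "2 * (y - 1) = n" using c y by auto
      then show ?thesis using y by auto
    qed (use c in auto)
  next
    assume "y = 1 \<or> even n \<and> y = n div 2 + 1"
    then show "int n dvd 2 * (int y - 1)" by (auto elim!: evenE)
  qed
  have "set axis_list = {y \<in> {1..n}. \<not> (y = 1 \<or> even n \<and> y = n div 2 + 1)}"
  proof (cases "odd n")
    case False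
    then obtain m where "n = 2 * m" by blast
    moreover from this have "n div 2 = m" by simp
    ultimately show ?thesis using n_ge_3 False unfolding axis_list_def by auto
  qed (auto simp: axis_list_def)
  then show ?thesis using key by auto
qed

lemma rel_axis: "dih (-1) 2 @ e_word axis_list \<approx> e_word axis_list"
  unfolding dih_HG axis_list_def
  by (rule word_equiv.base) (auto simp: relations_def R6_odd_def R6_even_def)

text \<open>The word \<open>e_word js\<close> can produce a copy of \<open>e_word axis_list\<close>
  on its left; \<open>R6\<close> lets that copy swallow the reflection, and it is then
  reabsorbed.\<close>

lemma reflection_1_absorbed:
  assumes "set js \<subseteq> {1..n}" "{y \<in> {1..n}. \<not> int n dvd 2 * (int y - 1)} \<subseteq> set js"
  shows "dih (-1) 2 @ e_word js \<approx> e_word js"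
proof -
  have absorb: "e_word axis_list @ e_word js \<approx> e_word js"
    using assms by (intro e_word_absorb) (auto simp: set_axis_list)
  have "dih (-1) 2 @ e_word js \<approx> (dih (-1) 2 @ e_word axis_list) @ e_word js"
    using equiv_left[OF equiv_sym[OF absorb]] by simp
  also have "\<dots> \<approx> e_word axis_list @ e_word js" by (rule equiv_right[OF rel_axis])
  also have "\<dots> \<approx> e_word js" by (rule absorb)
  finally show ?thesis .
qed

text \<open>The reflection fixing \<open>i\<close> is conjugate, by a rotation, to the reflection fixing \<open>1\<close>.\<close>

lemma reflection_absorbed:
  assumes js: "set js \<subseteq> {1..n}" "{y \<in> {1..n}. \<not> int n dvd 2 * (int y - i)} \<subseteq> set js"
  shows "dih (-1) (2 * i) @ e_word js \<approx> e_word js"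
proof -
  \<comment> \<open>The rotation by 1 - i takes the point \<open>i\<close> to 1, so
    \<open>?js\<close> meets the hypotheses of \<open>reflection_1_absorbed\<close>.\<close>
  let ?js = "map (act 1 (1 - i)) js"
  have shift: "act 1 (i - 1) (act 1 (1 - i) x) = x" "act 1 (1 - i) (act 1 (i - 1) x) = x"
    if "x \<in> {1..n}" for x
    using act_1_0[OF that] by (simp_all add: act_act)
  have shift_js: "map (act 1 (i - 1)) ?js = js" using shift(1) js(1) by (auto intro!: map_idI)
  have js': "set ?js \<subseteq> {1..n}" using act_in by auto
  have axis: "{y \<in> {1..n}. \<not> int n dvd 2 * (int y - 1)} \<subseteq> set ?js"
  proof clarify
    fix y assume y: "y \<in> {1..n}" "\<not> int n dvd 2 * (int y - 1)"
    let ?x = "act 1 (i - 1) y"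
    have "\<not> int n dvd 2 * (int ?x - i)"
    proof
      assume "int n dvd 2 * (int ?x - i)"
      then have "int n dvd 2 * (int ?x - i) + 2 * (1 * int y + (i - 1) - int ?x)"
        using act_dvd by (intro dvd_add dvd_mult[OF act_dvd]) simp_all
      also have "\<dots> = 2 * (int y - 1)" by (simp add: algebra_simps)
      finally show False using y(2) by simp
    qed
    then have "?x \<in> set js" using js(2) act_in by blast
    then show "y \<in> set ?js" using shift(2)[OF y(1)] by (metis image_eqI image_set)
  qed
  have slide: "e_word ?js @ dih 1 (i - 1) \<approx> dih 1 (i - 1) @ e_word js"
    using e_word_dih[OF _ js', of 1 "i - 1"] unfolding shift_js by simp
  \<comment> \<open>Shifting by 1 - i, reflecting by x -> 2 - x and shifting back is x -> 2i -
    x.\<close>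
  have "dih 1 (1 - i) @ dih (-1) 2 @ dih 1 (i - 1) \<approx> dih 1 (1 - i) @ dih (-1) (i + 1)"
    using equiv_left[OF dih_dih[of "-1" 1 2 "i - 1"]] by (simp add: add.commute)
  also have "\<dots> \<approx> dih (-1) (2 * i)" using dih_dih[of 1 "-1" "1 - i" "i + 1"] by simp
  finally have "dih (-1) (2 * i) @ e_word js \<approx> (dih 1 (1 - i) @ dih (-1) 2 @ dih 1 (i - 1)) @ e_word js"
    by (rule equiv_right[OF equiv_sym])
  also have "\<dots> \<approx> dih 1 (1 - i) @ dih (-1) 2 @ e_word ?js @ dih 1 (i - 1)"
    using equiv_left[OF equiv_sym[OF slide], of "dih 1 (1 - i) @ dih (-1) 2"] by simp
  also have "\<dots> \<approx> dih 1 (1 - i) @ e_word ?js @ dih 1 (i - 1)"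
    using equiv_context[OF reflection_1_absorbed[OF js' axis]] by simp
  also have "\<dots> \<approx> (dih 1 (1 - i) @ dih 1 (i - 1)) @ e_word js"
    using equiv_left[OF slide] by simp
  also have "\<dots> \<approx> dih 1 0 @ e_word js"
    using equiv_right[OF dih_dih[of 1 1 "1 - i" "i - 1"]] by simp
  finally show ?thesis by (simp add: dih_def rot_0)
qed

text \<open>The idempotent word stands for the empty map. It absorbs \<open>H\<close> and
  \<open>HG\<close>, hence also \<open>G\<close>, and so every dihedral word.\<close>

lemma zero_absorbs:
  assumes "s \<in> {1, -1}" "set js = {1..n}"
  shows "dih s k @ e_word js \<approx> e_word js"
proof -
  have H: "[H] @ e_word js \<approx> e_word js"
  proof (cases "odd n")
    case True
    \<comment> \<open>For odd \<open>n\<close> the reflection \<open>H\<close> fixes the point m =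
      (n + 1)/2, as 1 - x and 2m - x agree modulo \<open>n\<close>. For even \<open>n\<close> it
      fixes no point, and the second relation of \<open>R6_even\<close> is used instead.\<close>
    then obtain m where m: "int n + 1 = 2 * m" by (metis even_of_nat odd_even_add odd_one evenE)
    have "dih (-1) (2 * m) = dih (-1) 1" unfolding m[symmetric] by (rule dih_cong) simp
    moreover have "dih (-1) (2 * m) @ e_word js \<approx> e_word js"
      by (rule reflection_absorbed) (use assms(2) in blast)+
    ultimately show ?thesis by (simp add: dih_H)
  next
    case False
    let ?z = "e_word [1..<n + 1]"
    have "set [1..<n + 1] = {1..n}" by auto
    then have z: "e_word js \<approx> ?z"
      by (intro e_word_eqI) (simp_all only: assms(2) order_refl)
    have "[H] @ e_word js \<approx> [H] @ ?z" by (rule equiv_left[OF z])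
    also have "\<dots> \<approx> ?z"
      using False by (intro word_equiv.base) (simp add: relations_def R6_even_def)
    also have "\<dots> \<approx> e_word js" by (rule equiv_sym[OF z])
    finally show ?thesis .
  qed
  have HG: "[H, G] @ e_word js \<approx> e_word js"
    unfolding dih_HG[symmetric] by (rule reflection_1_absorbed) (use assms(2) in blast)+
  have "[G] @ e_word js \<approx> [H, H] @ [G] @ e_word js"
    using equiv_right[OF equiv_sym[OF rel_HH], of "[G] @ e_word js"] by simp
  also have "\<dots> \<approx> [H] @ e_word js" using equiv_left[OF HG, of "[H]"] by simp
  also note H
  finally have G: "[G] @ e_word js \<approx> e_word js" .
  have rep: "replicate m G @ e_word js \<approx> e_word js" for m
  proof (induction m)
    case (Suc m)
    have "replicate (Suc m) G @ e_word js \<approx> [G] @ e_word js"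
      using equiv_left[OF Suc, of "[G]"] by simp
    also note G
    finally show ?case .
  qed (simp add: equiv_refl)
  show ?thesis
  proof (cases "s = 1")
    case False
    have "[H] @ rot (k - 1) @ e_word js \<approx> [H] @ e_word js"
      unfolding rot_def by (rule equiv_left[OF rep])
    also note H
    finally show ?thesis using False by (simp add: dih_def)
  qed (simp add: dih_def rot_def rep)
qed

text \<open>If some point \<open>i\<close> survives, a rotation fixing it is trivial, and a
  reflection fixing it is x -> 2i - x. All points outside \<open>js\<close> then lie on the axis of
  this reflection, so \<open>reflection_absorbed\<close> applies.\<close>

lemma stabilizer_absorbed:
  assumes s: "s \<in> {1, -1}" and js: "set js \<subseteq> {1..n}"
    and fixed: "\<And>y. y \<in> {1..n} \<Longrightarrow> y \<notin> set js \<Longrightarrow> act s k y = y"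
  shows "dih s k @ e_word js \<approx> e_word js"
proof (cases "set js = {1..n}")
  case True
  then show ?thesis by (rule zero_absorbs[OF s])
next
  case False
  then obtain i where i: "i \<in> {1..n}" "i \<notin> set js" using js by blast
  have dvd: "int n dvd s * int y + k - int y" if "y \<in> {1..n}" "y \<notin> set js" for y
    using fixed[OF that] act_eq_iff[OF that(1)] by blast
  show ?thesis
  proof (cases "s = 1")
    case True
    have "dih s k = dih 1 0" unfolding True using dvd[OF i] True by (intro dih_cong) simp
    then show ?thesis by (simp add: dih_def rot_0 equiv_refl)
  next
    case False
    then have s1: "s = -1" using s by simp
    have "int n dvd k - 2 * int i" using dvd[OF i] s1 by (simp add: algebra_simps)
    then have "dih s k = dih (-1) (2 * int i)"
      unfolding s1 by (intro dih_cong) (simp add: mod_eq_dvd_iff)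
    moreover have "{y \<in> {1..n}. \<not> int n dvd 2 * (int y - int i)} \<subseteq> set js"
    proof clarify
      fix y assume y: "y \<in> {1..n}" "\<not> int n dvd 2 * (int y - int i)"
      show "y \<in> set js"
      proof (rule ccontr)
        \<comment> \<open>Subtracting the fixed-point conditions of \<open>i\<close> and
          \<open>y\<close> eliminates \<open>k\<close>.\<close>
        assume "y \<notin> set js"
        then have "int n dvd (s * int i + k - int i) - (s * int y + k - int y)"
          by (intro dvd_diff dvd i y(1))
        then show False using y(2) s1 by (simp add: algebra_simps)
      qed
    qed
    ultimately show ?thesis using reflection_absorbed[OF js] by simp
  qed
qed

section \<open>Evaluation of words\<close>

abbreviation ev :: "letter list \<Rightarrow> (nat \<rightharpoonup> nat)" where
  "ev \<equiv> word_eval (DPC n) (letter_map n)"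

text \<open>Even \<open>E j\<close> with \<open>j\<close> outside \<open>{1..n}\<close> denotes a
  partial isometry, namely the identity, so \<open>ev\<close> is multiplicative on all words, as
  suits \<open>word_equiv\<close>.\<close>

lemma letter_map_Pi: "letter_map n \<in> A \<rightarrow> carrier (DPC n)"
  using letter_map_in_DPC by blast

lemma ev_append: "ev (u @ v) = ev v \<circ>\<^sub>m ev u"
  using monoid.word_eval_append[OF monoid_DPC letter_map_Pi[of UNIV], of u v]
  by (simp add: DPC_def)

lemma ev_Nil: "ev [] = Some |` {1..n}"
  by (simp add: DPC_def)

lemma ev_letter: "ev [a] = letter_map n a"
  using monoid.r_one[OF monoid_DPC letter_map_in_DPC] by simp

definition dihedral_map :: "int \<Rightarrow> int \<Rightarrow> nat \<rightharpoonup> nat" where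
  "dihedral_map s k x = (if x \<in> {1..n} then Some (act s k x) else None)"

lemma dihedral_map_comp:
  "dihedral_map s' k' \<circ>\<^sub>m dihedral_map s k = dihedral_map (s' * s) (s' * k + k')"
  using act_in by (auto simp: dihedral_map_def map_comp_def act_act fun_eq_iff)

lemma dihedral_map_mod: "k mod int n = k' mod int n \<Longrightarrow> dihedral_map s k = dihedral_map s k'"
  using act_mod[of k k' s] by (simp add: dihedral_map_def fun_eq_iff)

lemma ev_Nil_dihedral: "ev [] = dihedral_map 1 0"
  unfolding ev_Nil using act_1_0 by (auto simp: dihedral_map_def fun_eq_iff restrict_map_def)

lemma ev_G: "ev [G] = dihedral_map 1 1"
  unfolding ev_letter using act_G by (auto simp: dihedral_map_def fun_eq_iff)

lemma ev_H: "ev [H] = dihedral_map (-1) 1"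
  unfolding ev_letter using act_H by (auto simp: dihedral_map_def fun_eq_iff)

lemma ev_replicate_G: "ev (replicate m G) = dihedral_map 1 (int m)"
proof (induction m)
  case 0
  then show ?case using ev_Nil_dihedral by simp
next
  case (Suc m)
  have "ev (replicate (Suc m) G) = ev (replicate m G) \<circ>\<^sub>m ev [G]"
    using ev_append[of "[G]"] by simp
  then show ?case unfolding Suc ev_G dihedral_map_comp by (simp add: add.commute)
qed

lemma ev_rot: "ev (rot k) = dihedral_map 1 k"
  unfolding rot_def ev_replicate_G using n_ge_3 by (intro dihedral_map_mod) simp

lemma ev_dih:
  assumes "s \<in> {1, -1}"
  shows "ev (dih s k) = dihedral_map s k"
proof (cases "s = 1")
  case False
  have "ev (H # rot (k - 1)) = ev (rot (k - 1)) \<circ>\<^sub>m ev [H]"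
    using ev_append[of "[H]"] by simp
  also have "\<dots> = dihedral_map (-1) k" unfolding ev_rot ev_H dihedral_map_comp by simp
  finally show ?thesis using False assms by (simp add: dih_def)
qed (simp add: dih_def ev_rot)

lemma ev_e_word: "ev (e_word js) = Some |` ({1..n} - set js)"
proof (induction js)
  case Nil
  then show ?case by (simp only: e_word_Nil ev_Nil) simp
next
  case (Cons j js)
  have "ev (e_word (j # js)) = ev (e_word js) \<circ>\<^sub>m ev [E j]"
    using ev_append[of "[E j]"] by (simp add: e_word_Cons)
  then show ?case unfolding Cons ev_letter
    by (auto simp: map_comp_def restrict_map_def fun_eq_iff)
qed

lemma ev_normal_form:
  assumes "s \<in> {1, -1}"
  shows "ev (dih s k @ e_word js) x =
    (if x \<in> {1..n} \<and> act s k x \<notin> set js then Some (act s k x) else None)"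
  unfolding ev_append ev_dih[OF assms] ev_e_word
  using act_in[of s k x] by (simp add: dihedral_map_def map_comp_def restrict_map_def)

section \<open>Validity of the relations for partial isometries\<close>

lemma ev_E_E: "ev [E i, E j] = Some |` ({1..n} - {i, j})"
  using ev_e_word[of "[i, j]"] by (simp add: e_word_def)

lemma ev_E_letter: "ev [E i, a] = (\<lambda>x. if x \<in> {1..n} - {i} then letter_map n a x else None)"
  using ev_append[of "[E i]" "[a]"] unfolding ev_letter
  by (auto simp: map_comp_def restrict_map_def fun_eq_iff)

lemma ev_letter_E: "ev [a, E i] = letter_map n a |` {x. letter_map n a x \<noteq> Some i}"
proof -
  have "y \<in> {1..n}" if "letter_map n a x = Some y" for x y
    using letter_map_in_DPC[of n a] that by (auto simp: DPC_def partial_isometry_iff)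
  then show ?thesis
    using ev_append[of "[a]" "[E i]"] unfolding ev_letter
    by (auto simp: map_comp_def restrict_map_def fun_eq_iff split: option.splits)
qed

text \<open>The semantic counterpart of \<open>stabilizer_absorbed\<close>, from which both kinds of
  \<open>R6\<close> relations are verified.\<close>

lemma ev_stabilizer:
  assumes s: "s \<in> {1, -1}"
    and fixed: "\<And>y. y \<in> {1..n} \<Longrightarrow> y \<notin> set js \<Longrightarrow> act s k y = y"
  shows "ev (dih s k @ e_word js) = ev (e_word js)"
proof
  fix x
  show "ev (dih s k @ e_word js) x = ev (e_word js) x"
  proof (cases "x \<in> {1..n} \<and> act s k x \<notin> set js")
    case True
    \<comment> \<open>A surviving image is itself a fixed point, so injectivity makes
      \<open>x\<close> fixed as well.\<close>
    then have "act s k (act s k x) = act s k x" using fixed act_in by blast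
    then have "act s k x = x" using act_inj[OF s] act_in True by blast
    then show ?thesis using True by (simp add: ev_normal_form[OF s] ev_e_word)
  next
    case False
    then have "x \<notin> {1..n} - set js" using fixed by fastforce
    then show ?thesis using False by (auto simp: ev_normal_form[OF s] ev_e_word)
  qed
qed

lemma act_axis:
  assumes "y \<in> {1..n}" "y \<notin> set axis_list"
  shows "act (-1) 2 y = y"
proof -
  have "int n dvd 2 * (int y - 1)" using assms unfolding set_axis_list by blast
  then have "int n dvd - (2 * (int y - 1))" unfolding dvd_minus_iff .
  also have "- (2 * (int y - 1)) = -1 * int y + 2 - int y" by simp
  finally show ?thesis using act_eq_iff[OF assms(1)] by blast
qed

lemma relations_sound:
  assumes "(l, r) \<in> relations n"
  shows "ev l = ev r"
proof -
  \<comment> \<open>For either parity, \<open>R6\<close> consists of the axis relation and possibly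
    the relation for the empty map.\<close>
  have R6_subset: "(if odd n then R6_odd n else R6_even n) \<subseteq>
      {(dih (-1) 2 @ e_word axis_list, e_word axis_list),
       ([H] @ e_word [1..<n + 1], e_word [1..<n + 1])}"
    unfolding R6_odd_def R6_even_def axis_list_def dih_HG by (cases "odd n") simp_all
  consider "(l, r) \<in> R1 n" | "(l, r) \<in> R2 n" | "(l, r) \<in> R3 n" | "(l, r) \<in> R4 n" | "(l, r) \<in> R5 n"
    | "l = dih (-1) 2 @ e_word axis_list" "r = e_word axis_list"
    | "l = [H] @ e_word [1..<n + 1]" "r = e_word [1..<n + 1]"
    using assms R6_subset unfolding relations_def by blast
  then show ?thesis
  proof cases
    case 1
    have "dihedral_map 1 (int n) = dihedral_map 1 0" by (rule dihedral_map_mod) simp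
    then have "ev (replicate n G) = ev []" by (simp only: ev_replicate_G ev_Nil_dihedral)
    moreover have "ev [H, H] = ev []"
      using ev_append[of "[H]" "[H]"] unfolding ev_H dihedral_map_comp ev_Nil_dihedral by simp
    moreover have "ev [H, G] = ev (replicate (n - 1) G @ [H])"
    proof -
      have "ev (replicate (n - 1) G @ [H]) = dihedral_map (-1) (- int (n - 1) + 1)"
        unfolding ev_append ev_H ev_replicate_G dihedral_map_comp by simp
      also have "\<dots> = dihedral_map (-1) 2"
        using n_ge_3 by (intro dihedral_map_mod) (simp add: mod_eq_dvd_iff of_nat_diff)
      finally show ?thesis using ev_dih[of "-1" 2] by (simp only: dih_HG) simp
    qed
    ultimately show ?thesis using 1 by (auto simp only: R1_def)
  next
    case 2
    then obtain i where "l = [E i, E i]" "r = [E i]" by (auto simp: R2_def)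
    then show ?thesis by (simp only: ev_E_E ev_letter letter_map.simps) simp
  next
    case 3
    then obtain i j where "l = [E i, E j]" "r = [E j, E i]" by (auto simp: R3_def)
    then show ?thesis by (simp only: ev_E_E insert_commute)
  next
    case 4
    then consider "l = [G, E 1]" "r = [E n, G]"
      | i where "1 \<le> i" "i \<le> n - 1" "l = [G, E (i + 1)]" "r = [E i, G]"
      by (auto simp: R4_def)
    then show ?thesis
      by cases (auto simp only: ev_E_letter ev_letter_E, auto simp: restrict_map_def fun_eq_iff)
  next
    case 5
    then obtain i where "1 \<le> i" "i \<le> n" "l = [H, E i]" "r = [E (n - i + 1), H]"
      by (auto simp: R5_def)
    then show ?thesis
      by (auto simp only: ev_E_letter ev_letter_E) (auto simp: restrict_map_def fun_eq_iff)
  next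
    case 6
    then show ?thesis using ev_stabilizer act_axis by blast
  next
    case 7
    \<comment> \<open>All points are deleted, so the fixed-point condition is vacuous.\<close>
    have "ev (dih (-1) 1 @ e_word [1..<n + 1]) = ev (e_word [1..<n + 1])"
      by (rule ev_stabilizer) auto
    then show ?thesis using 7 by (simp only: dih_H)
  qed
qed

lemma equiv_sound: "u \<approx> v \<Longrightarrow> ev u = ev v"
proof (induction rule: word_equiv.induct)
  case (base l r)
  then show ?case by (rule relations_sound)
qed (simp_all add: ev_append)

section \<open>Completeness of the relations\<close>

lemma act_surj:
  assumes "s \<in> {1, -1}" "y \<in> {1..n}"
  shows "\<exists>x \<in> {1..n}. act s k x = y"
proof
  show "act s (- s * k) y \<in> {1..n}" by (rule act_in)
  show "act s k (act s (- s * k) y) = y" using assms act_1_0 by (auto simp: act_act)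
qed

lemma equiv_complete:
  assumes "u \<in> lists (letters n)" "v \<in> lists (letters n)" "ev u = ev v"
  shows "u \<approx> v"
proof -
  obtain s k js where u: "s \<in> {1, -1}" "set js \<subseteq> {1..n}" "u \<approx> dih s k @ e_word js"
    using normal_form[OF assms(1)] by blast
  obtain s' k' js' where v: "s' \<in> {1, -1}" "set js' \<subseteq> {1..n}" "v \<approx> dih s' k' @ e_word js'"
    using normal_form[OF assms(2)] by blast
  have eq: "ev (dih s k @ e_word js) = ev (dih s' k' @ e_word js')"
    using equiv_sound[OF u(3)] equiv_sound[OF v(3)] assms(3) by simp
  \<comment> \<open>A point outside \<open>js1\<close> is attained by the first map, hence by the
    second from the same argument. Used in both directions, this recovers the deleted set from the
    image.\<close>
  have image: "y \<notin> set js2 \<and> act s2 k2 x = y"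
    if "ev (dih s1 k1 @ e_word js1) = ev (dih s2 k2 @ e_word js2)" "s1 \<in> {1, -1}" "s2 \<in> {1, -1}"
      "x \<in> {1..n}" "act s1 k1 x = y" "y \<notin> set js1" for s1 k1 s2 k2 js1 js2 x y
    using fun_cong[OF that(1), of x] that(2-)
    by (simp only: ev_normal_form) (simp split: if_splits)
  have js: "set js = set js'"
  proof -
    have "y \<in> set js \<longleftrightarrow> y \<in> set js'" if "y \<in> {1..n}" for y
      using act_surj[OF u(1) that] act_surj[OF v(1) that]
        image[OF eq u(1) v(1)] image[OF eq[symmetric] v(1) u(1)] by metis
    then show ?thesis using u(2) v(2) by blast
  qed
  \<comment> \<open>\<open>dih t m\<close> is the right quotient of the two dihedral parts:
    \<open>dih s' k'\<close> followed by it gives \<open>dih s k\<close>. The sign \<open>s'\<close>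
    is its own inverse, whence t = s s'.\<close>
  define t m where "t = s * s'" and "m = k - t * k'"
  have t: "t \<in> {1, -1}" "t * s' = s" using u(1) v(1) by (auto simp: t_def)
  have fixed: "act t m y = y" if y: "y \<in> {1..n}" "y \<notin> set js" for y
  proof -
    obtain x where x: "x \<in> {1..n}" "act s' k' x = y" using act_surj[OF v(1) y(1)] by blast
    then have "act s k x = y" using image[OF eq[symmetric] v(1) u(1)] y js by blast
    then show ?thesis using act_act[of t m s' k' x] t(2) x(2) by (simp add: m_def)
  qed
  have "u \<approx> dih s k @ e_word js" by (rule u(3))
  also have "\<dots> \<approx> (dih s' k' @ dih t m) @ e_word js"
    using dih_dih[OF v(1) t(1), of k' m] by (intro equiv_right[OF equiv_sym]) (simp add: t(2) m_def)
  also have "\<dots> \<approx> dih s' k' @ e_word js"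
    using equiv_left[OF stabilizer_absorbed[OF t(1) u(2) fixed]] by simp
  also have "\<dots> \<approx> dih s' k' @ e_word js'" by (rule equiv_left[OF e_word_eqI[OF js u(2)]])
  also have "\<dots> \<approx> v" by (rule equiv_sym[OF v(3)])
  finally show ?thesis .
qed

section \<open>Partial isometries are restrictions of dihedral permutations\<close>

text \<open>Geodesic distance determines a difference modulo \<open>n\<close> up to sign.\<close>

lemma cycle_dist_eq_imp_dvd:
  assumes "cycle_dist n a b = cycle_dist n c d"
  shows "int n dvd (int a - int b) - (int c - int d) \<or> int n dvd (int a - int b) + (int c - int d)"
proof -
  let ?x = "int a - int b" and ?y = "int c - int d"
  have "\<bar>?x\<bar> = \<bar>?y\<bar> \<or> \<bar>?x\<bar> = int n - \<bar>?y\<bar>"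
    using assms unfolding cycle_dist_def by (auto simp: min_def split: if_splits)
  then have "?x - ?y \<in> {0, int n, - int n} \<or> ?x + ?y \<in> {0, int n, - int n}" by auto
  then show ?thesis by auto
qed

text \<open>Differences from a base point \<open>p\<close> are preserved or negated modulo
  \<open>n\<close>. If some \<open>y\<close> has its difference not preserved, comparing
  \<open>y\<close> with any other point forces negation everywhere.\<close>

lemma partial_isometry_dihedral:
  assumes "partial_isometry n \<alpha>"
  obtains s k where "s \<in> {1, -1}" "\<forall>x x'. \<alpha> x = Some x' \<longrightarrow> act s k x = x'"
proof -
  have range: "x \<in> {1..n}" "x' \<in> {1..n}" if "\<alpha> x = Some x'" for x x'
    using that assms by (auto simp: partial_isometry_iff)
  have dist: "int n dvd (int x' - int y') - (int x - int y) \<or> int n dvd (int x' - int y') + (int x - int y)"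
    if "\<alpha> x = Some x'" "\<alpha> y = Some y'" for x x' y y'
    using that assms cycle_dist_eq_imp_dvd by (auto simp: partial_isometry_iff)
  show ?thesis
  proof (cases "\<exists>x x'. \<alpha> x = Some x'")
    case False
    then show ?thesis using that[of 1 0] by simp
  next
    case True
    then obtain p p' where p: "\<alpha> p = Some p'" by blast
    let ?N = "int n" and ?d = "\<lambda>x. int x - int p" and ?d' = "\<lambda>x'. int x' - int p'"
    \<comment> \<open>The offset p' - s p is the one taking \<open>p\<close> to \<open>p'\<close>,
      so only differences from \<open>p\<close> remain.\<close>
    have iff: "act s (int p' - s * int p) x = x' \<longleftrightarrow> ?N dvd s * ?d x - ?d' x'"
      if "\<alpha> x = Some x'" for s x x'
      using act_eq_iff[OF range(2)[OF that]] by (simp add: algebra_simps)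
    show ?thesis
    proof (cases "\<forall>y y'. \<alpha> y = Some y' \<longrightarrow> ?N dvd ?d y - ?d' y'")
      case True
      then show ?thesis using that[of 1 "int p' - 1 * int p"] iff[of _ _ 1] by simp
    next
      case False
      then obtain y y' where y: "\<alpha> y = Some y'" "\<not> ?N dvd ?d y - ?d' y'" by blast
      have y_neg: "?N dvd - ?d y - ?d' y'"
      proof -
        have "?N dvd ?d' y' - ?d y \<or> ?N dvd ?d' y' + ?d y" using dist[OF y(1) p] .
        moreover have "\<not> ?N dvd ?d' y' - ?d y" using y(2) by (metis dvd_diff_commute)
        ultimately have "?N dvd - (?d' y' + ?d y)" unfolding dvd_minus_iff by blast
        then show ?thesis by (simp add: algebra_simps)
      qed
      have "?N dvd - ?d z - ?d' z'" if z: "\<alpha> z = Some z'" for z z'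
      proof (rule ccontr)
        assume neg: "\<not> ?thesis"
        have "?N dvd ?d' z' - ?d z \<or> ?N dvd ?d' z' + ?d z" using dist[OF z p] .
        moreover have "\<not> ?N dvd ?d' z' + ?d z"
        proof
          assume "?N dvd ?d' z' + ?d z"
          then have "?N dvd - (?d' z' + ?d z)" unfolding dvd_minus_iff .
          then show False using neg by (simp add: algebra_simps)
        qed
        ultimately have z_pos: "?N dvd ?d' z' - ?d z" by blast
        \<comment> \<open>If the difference of \<open>y\<close> and \<open>z\<close> is preserved,
          \<open>z_pos\<close> makes that of \<open>y\<close> and \<open>p\<close> preserved,
          contradicting the choice of \<open>y\<close>. If it is negated, \<open>y_neg\<close> makes
          that of \<open>z\<close> and \<open>p\<close> negated, contradicting
          \<open>neg\<close>.\<close>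
        have "?N dvd (int y' - int z') - (int y - int z) \<or> ?N dvd (int y' - int z') + (int y - int z)"
          using dist[OF y(1) z] .
        then show False
        proof
          assume *: "?N dvd (int y' - int z') - (int y - int z)"
          have "?N dvd - (((int y' - int z') - (int y - int z)) + (?d' z' - ?d z))"
            unfolding dvd_minus_iff by (intro dvd_add * z_pos)
          then show False using y(2) by (simp add: algebra_simps)
        next
          assume *: "?N dvd (int y' - int z') + (int y - int z)"
          have "?N dvd ((int y' - int z') + (int y - int z)) + (- ?d y - ?d' y')"
            by (intro dvd_add * y_neg)
          then show False using neg by (simp add: algebra_simps)
        qed
      qed
      then show ?thesis using that[of "-1" "int p' - (-1) * int p"] iff[of _ _ "-1"] by simp
    qed
  qed
qed

lemma ev_surj:
  assumes "\<alpha> \<in> carrier (DPC n)"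
  shows "\<exists>w \<in> lists (letters n). ev w = \<alpha>"
proof -
  have iso: "partial_isometry n \<alpha>" using assms by (simp add: DPC_def)
  have dom: "x \<in> {1..n}" if "\<alpha> x = Some x'" for x x'
    using that iso by (auto simp: partial_isometry_iff)
  obtain s k where s: "s \<in> {1, -1}" and sk': "\<forall>x x'. \<alpha> x = Some x' \<longrightarrow> act s k x = x'"
    using partial_isometry_dihedral[OF iso] .
  have sk: "act s k x = x'" if "\<alpha> x = Some x'" for x x' using that sk' by blast
  \<comment> \<open>The idempotents act after the permutation, so they must delete the complement of
    the image, not of the domain.\<close>
  obtain js where js': "set js = {1..n} - ran \<alpha>"
    using finite_list[OF finite_Diff[OF finite_atLeastAtMost]] by blast
  have js: "y \<in> set js \<longleftrightarrow> y \<in> {1..n} \<and> y \<notin> ran \<alpha>" for y unfolding js' by blast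
  have "ev (dih s k @ e_word js) x = \<alpha> x" for x
  proof (cases "\<alpha> x")
    case (Some x')
    moreover have "x' \<in> ran \<alpha>" using Some by (auto simp: ran_def)
    ultimately show ?thesis
      using dom[OF Some] sk[OF Some] js by (simp only: ev_normal_form[OF s]) simp
  next
    case None
    \<comment> \<open>Outside the domain the permutation must land on a deleted point: a value in
      the image is already taken by a point \<open>z\<close> of the domain, and injectivity would
      give z = x.\<close>
    have "act s k x \<notin> ran \<alpha>" if x: "x \<in> {1..n}"
    proof
      assume "act s k x \<in> ran \<alpha>"
      then obtain z where z: "\<alpha> z = Some (act s k x)" by (auto simp: ran_def)
      then have "z = x" using act_inj[OF s dom[OF z] x] sk[OF z] by blast
      then show False using z None by simp
    qed
    then show ?thesis
      using None js act_in[of s k x] by (simp only: ev_normal_form[OF s]) auto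
  qed
  moreover have "dih s k @ e_word js \<in> lists (letters n)"
    using js by (auto simp: dih_def rot_def e_word_def letters_def split: if_splits)
  ultimately show ?thesis by blast
qed

lemma relations_lists: "relations n \<subseteq> lists (letters n) \<times> lists (letters n)"
  using n_ge_3
  by (auto simp: relations_def R1_def R2_def R3_def R4_def R5_def R6_odd_def R6_even_def
      e_word_def letters_def)

end

theorem theorem2p7:
  fixes n :: nat
  assumes "n \<ge> 3"
  shows "card (letters n) = n + 2 \<and>
    defined_by_presentation (DPC n) (letters n) (relations n) \<and>
    defined_by_presentation_via (letter_map n) (DPC n) (letters n) (relations n)"
proof -
  interpret cycle n by unfold_locales (rule assms)
  have "defined_by_presentation (DPC n) (letters n) (relations n) \<and>
      defined_by_presentation_via (letter_map n) (DPC n) (letters n) (relations n)"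
    by (rule monoid.defined_by_presentationI[OF monoid_DPC letter_map_Pi relations_lists
          relations_sound equiv_complete ev_surj])
  then show ?thesis using card_letters by blast
qed

end
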